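(* Let $K$ be a field and let $I$ be a proper monomial ideal of $R=K[x_1,\ldots,x_n]$. Then the Newton polyhedron $NP(I)$, the symbolic polyhedron $SP(I)$ and the irreducible polyhedron $IP(I)$ of $I$ satisfy $$NP(I)\subseteq SP(I)\subseteq IP(I).$$
   Context: $\mathbb{N}$ denotes the nonnegative integers, and $\mathbf{x}^{\mathbf{a}}=x_1^{a_1}\cdots x_n^{a_n}$ for $\mathbf{a}=(a_1,\ldots,a_n)\in\mathbb{N}^n$. A monomial ideal is an ideal of $R$ generated by monomials. Newton polyhedron: for a monomial ideal $J$, $NP(J)\subseteq\mathbb{R}^n$ is the convex hull of $\{\mathbf{a}\in\mathbb{N}^n \mid \mathbf{x}^{\mathbf{a}}\in J\}$. Symbolic polyhedron: let $I=Q_1\cap\cdots\cap Q_s$ be a primary decomposition of $I$ into monomial ideals, and let $\mathrm{Max}(I)$ be the set of maximal elements, with respect to containment, of the set $\mathrm{Ass}(R/I)$ of associated primes of $I$. For $P\in \mathrm{Max}(I)$ set $Q_{\subseteq P}=\bigcap_{\sqrt{Q_i}\subseteq P}Q_i$. Then $SP(I)=\bigcap_{P\in \mathrm{Max}(I)}NP(Q_{\subseteq P})$. This does not depend on the choice of primary decomposition. Irreducible polyhedron: a proper monomial ideal is irreducible (not an intersection of two strictly larger ideals) if and only if it is generated by positive powers of some of the variables. Every proper monomial ideal $I$ can be written as a finite intersection $I=J_1\cap\cdots\cap J_s$ of irreducible monomial ideals (a monomial irreducible decomposition). Then $IP(I)=NP(J_1)\cap\cdots\cap NP(J_s)$. This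 does not depend on the chosen decomposition. *)

theory Defs
  imports
    "HOL-Analysis.Analysis"
    "HOL-Library.Poly_Mapping"
    "HOL-Algebra.Algebraic_Closure_Type"
begin

section \<open>Ideals of a commutative ring\<close>

definition radical_ideal :: "('a, 'b) ring_scheme \<Rightarrow> 'a set \<Rightarrow> 'a set" where
  "radical_ideal R J = {x \<in> carrier R. \<exists>m::nat. x [^]\<^bsub>R\<^esub> m \<in> J}"

definition primary_ideal :: "'a set \<Rightarrow> ('a, 'b) ring_scheme \<Rightarrow> bool" where
  "primary_ideal Q R \<longleftrightarrow> ideal Q R \<and> Q \<noteq> carrier R \<and>
     (\<forall>x \<in> carrier R. \<forall>y \<in> carrier R. x \<otimes>\<^bsub>R\<^esub> y \<in> Q \<longrightarrow> x \<in> Q \<or> y \<in> radical_ideal R Q)"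

definition irreducible_ideal :: "'a set \<Rightarrow> ('a, 'b) ring_scheme \<Rightarrow> bool" where
  "irreducible_ideal J R \<longleftrightarrow> ideal J R \<and> J \<noteq> carrier R \<and>
     \<not> (\<exists>J\<^sub>1 J\<^sub>2. ideal J\<^sub>1 R \<and> ideal J\<^sub>2 R \<and> J \<subset> J\<^sub>1 \<and> J \<subset> J\<^sub>2 \<and> J = J\<^sub>1 \<inter> J\<^sub>2)"

text \<open>\<open>Ass(R/J)\<close>: the primes of the form \<open>(J : f)\<close>, which is the annihilator of
  the residue class of \<open>f\<close> in the module \<open>R/J\<close>.\<close>

definition associated_primes :: "('a, 'b) ring_scheme \<Rightarrow> 'a set \<Rightarrow> 'a set set" where
  "associated_primes R J =
     {P. primeideal P R \<and> (\<exists>f \<in> carrier R. P = {g \<in> carrier R. g \<otimes>\<^bsub>R\<^esub> f \<in> J})}"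

definition max_associated_primes :: "('a, 'b) ring_scheme \<Rightarrow> 'a set \<Rightarrow> 'a set set" where
  "max_associated_primes R J =
     {P \<in> associated_primes R J. \<forall>P' \<in> associated_primes R J. P \<subseteq> P' \<longrightarrow> P' = P}"


section \<open>Monomial ideals of a polynomial ring\<close>

text \<open>The polynomial ring over \<open>'k\<close> in the variables indexed by the finite type \<open>'n\<close>
  (so the number of variables is \<open>CARD('n)\<close>): a polynomial maps exponent vectors to
  coefficients, and the multiplication of \<^typ>\<open>'a \<Rightarrow>\<^sub>0 'b\<close> is convolution.\<close>

type_synonym ('n, 'k) mpoly = "('n \<Rightarrow>\<^sub>0 nat) \<Rightarrow>\<^sub>0 'k"

abbreviation mpoly_ring :: "('n, 'k::field) mpoly ring" where
  "mpoly_ring \<equiv> ring_of_type_algebra"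

definition monomial :: "('n \<Rightarrow>\<^sub>0 nat) \<Rightarrow> ('n, 'k::field) mpoly" where
  "monomial a = Poly_Mapping.single a 1"

definition monomial_ideal :: "('n, 'k::field) mpoly set \<Rightarrow> bool" where
  "monomial_ideal J \<longleftrightarrow> (\<exists>A. J = Idl\<^bsub>mpoly_ring\<^esub> (monomial ` A))"

definition exponent_point :: "('n::finite \<Rightarrow>\<^sub>0 nat) \<Rightarrow> real ^ 'n" where
  "exponent_point a = (\<chi> i. real (Poly_Mapping.lookup a i))"

definition newton_polyhedron :: "('n::finite, 'k::field) mpoly set \<Rightarrow> (real ^ 'n) set" where
  "newton_polyhedron J = convex hull {exponent_point a | a. monomial a \<in> J}"


section \<open>The symbolic polyhedron\<close>

definition monomial_primary_decomposition ::
  "('n, 'k::field) mpoly set set \<Rightarrow> ('n, 'k) mpoly set \<Rightarrow> bool" where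
  "monomial_primary_decomposition Qs J \<longleftrightarrow>
     finite Qs \<and> (\<forall>Q \<in> Qs. monomial_ideal Q \<and> primary_ideal Q mpoly_ring) \<and> J = \<Inter> Qs"

text \<open>\<open>Q\<^bsub>\<subseteq>P\<^esub>\<close>\<close>

definition components_below ::
  "('n, 'k::field) mpoly set set \<Rightarrow> ('n, 'k) mpoly set \<Rightarrow> ('n, 'k) mpoly set" where
  "components_below Qs P = \<Inter> {Q \<in> Qs. radical_ideal mpoly_ring Q \<subseteq> P}"

text \<open>The polyhedron is the same for every choice of the decomposition, so it is
  introduced as the unique set arising from one; likewise for the irreducible
  polyhedron below.\<close>

definition symbolic_polyhedron :: "('n::finite, 'k::field) mpoly set \<Rightarrow> (real ^ 'n) set" where
  "symbolic_polyhedron J = (THE S. \<exists>Qs. monomial_primary_decomposition Qs J \<and>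
     S = (\<Inter>P \<in> max_associated_primes mpoly_ring J. newton_polyhedron (components_below Qs P)))"


section \<open>The irreducible polyhedron\<close>

definition monomial_irreducible_decomposition ::
  "('n, 'k::field) mpoly set set \<Rightarrow> ('n, 'k) mpoly set \<Rightarrow> bool" where
  "monomial_irreducible_decomposition Js J \<longleftrightarrow>
     finite Js \<and> (\<forall>J' \<in> Js. monomial_ideal J' \<and> irreducible_ideal J' mpoly_ring) \<and> J = \<Inter> Js"

definition irreducible_polyhedron :: "('n::finite, 'k::field) mpoly set \<Rightarrow> (real ^ 'n) set" where
  "irreducible_polyhedron J = (THE S. \<exists>Js. monomial_irreducible_decomposition Js J \<and>
     S = (\<Inter>J' \<in> Js. newton_polyhedron J'))"

end

theory Submission
  imports Defs
begin

abbreviation (input) "lookup \<equiv> Poly_Mapping.lookup"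
abbreviation (input) "keys \<equiv> Poly_Mapping.keys"

text \<open>A monomial ideal is determined by its upward closed set of exponents. By Dickson's lemma and
  distributivity this set is a finite irredundant intersection of corners
  \<open>{a. \<exists>i. a\<^sub>i \<in> T i}\<close>, the exponent sets of the ideals generated by powers of
  variables. Comparing terms of minimal degree shows that such ideals are primary and irreducible,
  so one decomposition computes both \<open>SP(I)\<close> and \<open>IP(I)\<close>. Then \<open>NP(I) \<subseteq> SP(I)\<close> because
  \<open>I \<subseteq> Q\<^bsub>\<subseteq>P\<^esub>\<close>, and \<open>SP(I) \<subseteq> IP(I)\<close> because the radical of each component \<open>J\<close> is an
  associated prime and lies in a maximal one \<open>P\<close>, whence \<open>Q\<^bsub>\<subseteq>P\<^esub> \<subseteq> J\<close>. Independence of the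
  decomposition: \<open>Q\<^bsub>\<subseteq>P\<^esub>\<close> is a localisation, and an irreducible monomial ideal containing
  \<open>K\<^sub>1 \<inter> \<dots> \<inter> K\<^sub>r\<close> contains some \<open>K\<^sub>j\<close> by taking least common multiples.\<close>

section \<open>Ideals of the ring of a type class\<close>

lemma ring_of_type_simps [simp]:
  "carrier ring_of_type_algebra = UNIV"
  "x \<otimes>\<^bsub>ring_of_type_algebra\<^esub> y = x * y"
  "x \<oplus>\<^bsub>ring_of_type_algebra\<^esub> y = x + y"
  "\<one>\<^bsub>ring_of_type_algebra\<^esub> = 1"
  "\<zero>\<^bsub>ring_of_type_algebra\<^esub> = 0"
  by (simp_all add: ring_of_type_algebra_def)

lemma ring_of_type_pow [simp]: "x [^]\<^bsub>ring_of_type_algebra\<^esub> (m::nat) = x ^ m"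
  for x :: "'a::comm_ring_1"
  by (induction m) (simp_all add: nat_pow_def mult.commute)

lemma ideal_type_iff:
  fixes J :: "'a::comm_ring_1 set"
  shows "ideal J ring_of_type_algebra \<longleftrightarrow>
    0 \<in> J \<and> (\<forall>x\<in>J. \<forall>y\<in>J. x + y \<in> J) \<and> (\<forall>x\<in>J. \<forall>r. r * x \<in> J)" (is "_ \<longleftrightarrow> ?R")
proof
  assume J: "ideal J ring_of_type_algebra"
  then interpret ideal J ring_of_type_algebra .
  show ?R
    using additive_subgroup.zero_closed[OF is_additive_subgroup]
      additive_subgroup.a_closed[OF is_additive_subgroup] I_l_closed by simp
next
  assume R: ?R
  interpret cring "ring_of_type_algebra :: 'a ring"
    by (rule cring_from_type_algebra)
  have inv: "\<ominus>\<^bsub>ring_of_type_algebra\<^esub> x = - x" for x :: 'a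
    using minus_equality[of "- x" x] by simp
  have um: "- x \<in> J" if "x \<in> J" for x
    using R that by (metis mult_minus1)
  have "subgroup J (add_monoid ring_of_type_algebra)"
    using R um inv by (intro add.subgroupI) (auto simp: a_inv_def)
  then show "ideal J ring_of_type_algebra"
    using R by (intro idealI ring_axioms) (auto simp: mult.commute)
qed

lemma primeideal_type_iff:
  fixes P :: "'a::comm_ring_1 set"
  shows "primeideal P ring_of_type_algebra \<longleftrightarrow>
    ideal P ring_of_type_algebra \<and> 1 \<notin> P \<and> (\<forall>x y. x * y \<in> P \<longrightarrow> x \<in> P \<or> y \<in> P)"
    (is "_ \<longleftrightarrow> ?R")
proof
  assume P: "primeideal P ring_of_type_algebra"
  then interpret primeideal P ring_of_type_algebra .
  have "1 \<notin> P"
    using I_notcarr one_imp_carrier by auto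
  then show ?R
    using I_prime is_ideal by auto
next
  assume R: ?R
  have "cring (ring_of_type_algebra :: 'a ring)"
    by (rule cring_from_type_algebra)
  with R show "primeideal P ring_of_type_algebra"
    by (intro primeidealI) auto
qed

lemma radical_ideal_type: "radical_ideal ring_of_type_algebra J = {x :: 'a::comm_ring_1. \<exists>m. x ^ m \<in> J}"
  by (simp add: radical_ideal_def)

section \<open>Monomial ideals as sets of exponents\<close>

definition up_closed :: "('n \<Rightarrow>\<^sub>0 nat) set \<Rightarrow> bool" where
  "up_closed E \<longleftrightarrow> (\<forall>a\<in>E. \<forall>c. a + c \<in> E)"

text \<open>The linear span of the monomials with exponents in \<open>E\<close>. For
  \<open>E\<close> closed upward it is a monomial ideal, and every monomial ideal arises this
  way.\<close>

definition supported :: "('n \<Rightarrow>\<^sub>0 nat) set \<Rightarrow> ('n, 'k::field) mpoly set" where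
  "supported E = {f. keys f \<subseteq> E}"

text \<open>The upward closure of \<open>A\<close> for divisibility: the exponents of all multiples
  of its monomials.\<close>

definition translates :: "('n \<Rightarrow>\<^sub>0 nat) set \<Rightarrow> ('n \<Rightarrow>\<^sub>0 nat) set" where
  "translates A = {a + c | a c. a \<in> A}"

lemma lookup_diff_exponent: "lookup (a - b) i = lookup a i - lookup b i" for a b :: "'n \<Rightarrow>\<^sub>0 nat"
  by (rule fun_cong[OF minus_poly_mapping.rep_eq])

lemma up_closedD: "up_closed E \<Longrightarrow> a \<in> E \<Longrightarrow> a + c \<in> E"
  by (simp add: up_closed_def)

lemma up_closed_translates [simp]: "up_closed (translates A)"
  by (auto simp: up_closed_def translates_def) (metis add.assoc)

lemma up_closed_Un: "up_closed E \<Longrightarrow> up_closed F \<Longrightarrow> up_closed (E \<union> F)"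
  by (auto simp: up_closed_def)

lemma subset_translates: "A \<subseteq> translates A"
  by (auto simp: translates_def) (metis add_0_right)

lemma keys_monomial [simp]: "keys (monomial a :: ('n, 'k::field) mpoly) = {a}"
  by (simp add: monomial_def)

lemma monomial_in_supported [simp]: "monomial a \<in> supported E \<longleftrightarrow> a \<in> E"
  by (simp add: supported_def)

lemma supported_eq_iff [simp]: "(supported E :: ('n, 'k::field) mpoly set) = supported F \<longleftrightarrow> E = F"
  by (metis monomial_in_supported subsetI subset_antisym)

lemma supported_mono: "E \<subseteq> F \<Longrightarrow> supported E \<subseteq> supported F"
  by (auto simp: supported_def)

lemma one_in_supported [simp]: "1 \<in> supported E \<longleftrightarrow> 0 \<in> E"
  by (simp add: supported_def)

lemma supported_INT: "supported (\<Inter>i\<in>M. G i) = (\<Inter>i\<in>M. supported (G i))"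
  by (auto simp: supported_def)

lemma ideal_supported:
  assumes "up_closed E"
  shows "ideal (supported E :: ('n, 'k::field) mpoly set) mpoly_ring"
proof -
  have "f + g \<in> supported E" if "f \<in> supported E" "g \<in> supported E" for f g :: "('n, 'k) mpoly"
    using that Poly_Mapping.keys_add[of f g] by (auto simp: supported_def)
  moreover have "r * f \<in> supported E" if "f \<in> supported E" for f r :: "('n, 'k) mpoly"
    using that keys_mult[of f r] up_closedD[OF assms]
    by (fastforce simp: supported_def mult.commute)
  ultimately show ?thesis
    by (auto simp: ideal_type_iff supported_def)
qed

lemma mpoly_expand: "f = (\<Sum>a\<in>keys f. Poly_Mapping.single a (lookup f a))"
  for f :: "('n, 'k::field) mpoly"
proof (rule poly_mapping_eqI)
  fix k
  have "(\<Sum>a\<in>keys f. lookup (Poly_Mapping.single a (lookup f a)) k)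
      = (\<Sum>a\<in>keys f. if a = k then lookup f k else 0)"
    by (intro sum.cong) (auto simp: lookup_single)
  then show "lookup f k = lookup (\<Sum>a\<in>keys f. Poly_Mapping.single a (lookup f a)) k"
    by (auto simp: lookup_sum not_in_keys_iff_lookup_eq_zero)
qed

lemma Idl_monomials:
  "Idl\<^bsub>mpoly_ring\<^esub> (monomial ` A) = (supported (translates A) :: ('n, 'k::field) mpoly set)"
proof (rule antisym)
  interpret ring "mpoly_ring :: ('n, 'k) mpoly ring"
    by (rule ring_from_type_algebra)
  show "Idl\<^bsub>mpoly_ring\<^esub> (monomial ` A) \<subseteq> (supported (translates A) :: ('n, 'k) mpoly set)"
    by (rule genideal_minimal) (use subset_translates[of A] in \<open>auto simp: ideal_supported\<close>)
  show "(supported (translates A) :: ('n, 'k) mpoly set) \<subseteq> Idl\<^bsub>mpoly_ring\<^esub> (monomial ` A)"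
    unfolding genideal_def
  proof clarify
    fix f :: "('n, 'k) mpoly" and J :: "('n, 'k) mpoly set"
    assume f: "f \<in> supported (translates A)" and J: "ideal J mpoly_ring" "monomial ` A \<subseteq> J"
    have "Poly_Mapping.single b (lookup f b) \<in> J" if b: "b \<in> keys f" for b
    proof -
      obtain a c where ac: "b = a + c" "a \<in> A"
        using f b by (auto simp: supported_def translates_def)
      have "Poly_Mapping.single b (lookup f b) = Poly_Mapping.single c (lookup f b) * monomial a"
        using ac by (simp add: mult_single monomial_def add.commute)
      then show ?thesis
        using J ac by (auto simp: ideal_type_iff)
    qed
    moreover have "sum h M \<in> J" if "finite M" "\<And>x. x \<in> M \<Longrightarrow> h x \<in> J" for h :: "_ \<Rightarrow> ('n, 'k) mpoly" and M :: "('n \<Rightarrow>\<^sub>0 nat) set"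
      using that J by (induction M rule: finite_induct) (auto simp: ideal_type_iff)
    ultimately show "f \<in> J"
      by (subst mpoly_expand) simp
  qed
qed

lemma translates_up_closed: "up_closed E \<Longrightarrow> translates E = E"
  using subset_translates[of E] by (auto simp: translates_def up_closed_def)

lemma monomial_ideal_iff: "monomial_ideal J \<longleftrightarrow> (\<exists>E. up_closed E \<and> J = supported E)"
  unfolding monomial_ideal_def Idl_monomials
  by (metis up_closed_translates translates_up_closed)

lemma monomial_ideal_supported: "up_closed E \<Longrightarrow> monomial_ideal (supported E)"
  by (auto simp: monomial_ideal_iff)

lemma mpoly_split:
  fixes f :: "('n, 'k::field) mpoly"
  obtains g h where "f = g + h" "keys g = keys f \<inter> E" "keys h = keys f - E"
proof -
  define part where "part M = (\<Sum>a\<in>keys f \<inter> M. Poly_Mapping.single a (lookup f a))" for M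
  have look: "lookup (part M) k = (if k \<in> M then lookup f k else 0)" for M k
  proof -
    have "lookup (part M) k = (\<Sum>a\<in>keys f \<inter> M. if a = k then lookup f k else 0)"
      unfolding part_def lookup_sum by (intro sum.cong) (auto simp: lookup_single)
    then show ?thesis
      by (auto simp: not_in_keys_iff_lookup_eq_zero)
  qed
  show ?thesis
  proof
    show "f = part E + part (- E)"
      by (rule poly_mapping_eqI) (simp add: lookup_add look)
  qed (auto simp: in_keys_iff look split: if_splits)
qed

section \<open>Terms of minimal degree\<close>

definition partial_degree :: "'n set \<Rightarrow> ('n::finite \<Rightarrow>\<^sub>0 nat) \<Rightarrow> nat" where
  "partial_degree S a = (\<Sum>i\<in>S. lookup a i)"

lemma partial_degree_add: "partial_degree S (a + b) = partial_degree S a + partial_degree S b"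
  by (simp add: partial_degree_def lookup_add sum.distrib)

text \<open>An additive encoding whose lexicographic order, smallest index first, is a monomial
  order: the degree in \<open>S\<close> at index 0 is compared first, and the exponents behind it
  make the code injective.\<close>

definition degree_lex_code :: "'n set \<Rightarrow> ('n::finite \<Rightarrow>\<^sub>0 nat) \<Rightarrow> (nat \<Rightarrow>\<^sub>0 nat)" where
  "degree_lex_code S a = Poly_Mapping.single 0 (partial_degree S a)
     + (\<Sum>i\<in>UNIV. Poly_Mapping.single (Suc (to_nat i)) (lookup a i))"

lemma degree_lex_code_add:
  "degree_lex_code S (a + b) = degree_lex_code S a + degree_lex_code S b"
  by (simp add: degree_lex_code_def partial_degree_add lookup_add single_add sum.distrib algebra_simps)

lemma lookup_degree_lex_code:
  "lookup (degree_lex_code S a) 0 = partial_degree S a"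
  "lookup (degree_lex_code S a) (Suc (to_nat i)) = lookup a i"
proof -
  have "(\<Sum>j\<in>UNIV. lookup (Poly_Mapping.single (Suc (to_nat j)) (lookup a j)) (Suc (to_nat i)))
      = (\<Sum>j\<in>UNIV. if j = i then lookup a i else 0)"
    by (intro sum.cong) (auto simp: lookup_single when_def)
  then show "lookup (degree_lex_code S a) (Suc (to_nat i)) = lookup a i"
    by (simp add: degree_lex_code_def lookup_add lookup_sum lookup_single)
  show "lookup (degree_lex_code S a) 0 = partial_degree S a"
    by (simp add: degree_lex_code_def lookup_add lookup_sum lookup_single)
qed

lemma inj_degree_lex_code: "inj (degree_lex_code S)"
  by (rule injI, rule poly_mapping_eqI) (metis lookup_degree_lex_code(2))

lemma degree_lex_code_le:
  assumes "degree_lex_code S a \<le> degree_lex_code S b"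
  shows "partial_degree S a \<le> partial_degree S b"
proof -
  have "lookup p 0 \<le> lookup q 0" if "p \<le> q" for p q :: "nat \<Rightarrow>\<^sub>0 nat"
    using that unfolding less_eq_poly_mapping.rep_eq less_fun_def
    by (metis bot_nat_0.not_eq_extremum linorder_not_less nless_le order_refl)
  from this[OF assms] show ?thesis
    by (simp add: lookup_degree_lex_code)
qed

text \<open>For the order of \<open>degree_lex_code\<close>, the product of the two least terms is
  met by no other product of terms, so it cannot cancel.\<close>

lemma min_term_mult:
  fixes f g :: "('n::finite, 'k::field) mpoly"
  assumes "f \<noteq> 0" "g \<noteq> 0"
  obtains a b where "a \<in> keys f" "b \<in> keys g" "a + b \<in> keys (f * g)"
    "\<And>c. c \<in> keys g \<Longrightarrow> partial_degree S b \<le> partial_degree S c"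
proof -
  let ?c = "degree_lex_code S"
  have ex: "\<exists>a\<in>keys p. \<forall>c\<in>keys p. ?c a \<le> ?c c" if "p \<noteq> 0" for p :: "('n, 'k) mpoly"
  proof -
    have "finite (?c ` keys p)" "?c ` keys p \<noteq> {}"
      using that by auto
    from Min_in[OF this] Min_le[OF this(1)] show ?thesis
      by (metis (no_types, lifting) imageE imageI)
  qed
  obtain a where a: "a \<in> keys f" "\<And>c. c \<in> keys f \<Longrightarrow> ?c a \<le> ?c c"
    using ex[OF assms(1)] by blast
  obtain b where b: "b \<in> keys g" "\<And>c. c \<in> keys g \<Longrightarrow> ?c b \<le> ?c c"
    using ex[OF assms(2)] by blast
  have sep: "a' = a \<and> b' = b" if "a + b = a' + b'" "a' \<in> keys f" "b' \<in> keys g" for a' b'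
  proof -
    have "?c a + ?c b = ?c a' + ?c b'"
      using that(1) by (metis degree_lex_code_add)
    then have "?c a = ?c a' \<and> ?c b = ?c b'"
      using a(2)[OF that(2)] b(2)[OF that(3)]
      by (metis add_le_cancel_left add_le_cancel_right add_left_mono antisym)
    then show ?thesis
      using inj_degree_lex_code by (metis injD)
  qed
  obtain f1 f2 where f: "f = f1 + f2" "keys f1 = keys f \<inter> {a}" "keys f2 = keys f - {a}"
    by (rule mpoly_split)
  obtain g1 g2 where g: "g = g1 + g2" "keys g1 = keys g \<inter> {b}" "keys g2 = keys g - {b}"
    by (rule mpoly_split)
  have kf: "f1 = Poly_Mapping.single a (lookup f1 a)" and kg: "g1 = Poly_Mapping.single b (lookup g1 b)"
    using mpoly_expand[of f1] mpoly_expand[of g1] f(2) g(2) a(1) b(1) by auto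
  have nz: "lookup f1 a * lookup g1 b \<noteq> 0"
    using f(2) g(2) a(1) b(1) by (auto simp: in_keys_iff)
  have "a + b \<notin> keys (f1 * g2)" "a + b \<notin> keys (f2 * g)"
    using keys_mult[of f1 g2] keys_mult[of f2 g] sep f(2,3) g(3) a(1) by blast+
  moreover have "f * g = f1 * g1 + f1 * g2 + f2 * g"
    by (simp add: f(1) g(1) algebra_simps)
  moreover have "lookup (f1 * g1) (a + b) = lookup f1 a * lookup g1 b"
    by (subst kf, subst kg) (simp add: mult_single)
  ultimately have "a + b \<in> keys (f * g)"
    using nz by (simp add: in_keys_iff lookup_add)
  then show ?thesis
    using that a(1) b degree_lex_code_le by blast
qed

section \<open>Ideals generated by powers of variables\<close>

definition corner :: "('n \<Rightarrow> nat set) \<Rightarrow> ('n \<Rightarrow>\<^sub>0 nat) set" where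
  "corner T = {a. \<exists>i. lookup a i \<in> T i}"

text \<open>Each \<open>T i\<close> is empty or a final segment \<open>{m..}\<close> with
  \<open>m > 0\<close>, standing for the generator \<open>x_i^m\<close>. Excluding 0 keeps the ideal
  proper.\<close>

definition staircase :: "('n \<Rightarrow> nat set) \<Rightarrow> bool" where
  "staircase T \<longleftrightarrow> (\<forall>i. 0 \<notin> T i \<and> (\<forall>m\<in>T i. \<forall>k. m + k \<in> T i))"

text \<open>Replaces each occurring power of a variable by the variable itself, which gives the
  generators of the radical.\<close>

definition rad :: "('n \<Rightarrow> nat set) \<Rightarrow> ('n \<Rightarrow> nat set)" where
  "rad T = (\<lambda>i. if T i = {} then {} else {0<..})"

lemma in_corner_iff: "a \<in> corner T \<longleftrightarrow> (\<exists>i. lookup a i \<in> T i)"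
  by (simp add: corner_def)

lemma in_corner_rad_iff: "a \<in> corner (rad T) \<longleftrightarrow> (\<exists>i. T i \<noteq> {} \<and> 0 < lookup a i)"
  by (auto simp: corner_def rad_def split: if_splits)

lemma up_closed_corner: "staircase T \<Longrightarrow> up_closed (corner T)"
  by (auto simp: staircase_def up_closed_def corner_def lookup_add)

lemma zero_notin_corner: "staircase T \<Longrightarrow> 0 \<notin> corner T"
  by (auto simp: staircase_def corner_def)

lemma staircase_rad: "staircase (rad T)"
  by (auto simp: staircase_def rad_def)

lemma rad_rad [simp]: "rad (rad T) = rad T"
  by (auto simp: rad_def fun_eq_iff)

lemma corner_subset_rad:
  assumes "staircase T"
  shows "corner T \<subseteq> corner (rad T)"
proof
  fix a assume "a \<in> corner T"
  then obtain i where i: "lookup a i \<in> T i"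
    by (auto simp: in_corner_iff)
  with assms have "0 < lookup a i"
    by (metis staircase_def gr0I)
  with i show "a \<in> corner (rad T)"
    by (auto simp: in_corner_rad_iff)
qed

text \<open>For nonempty \<open>T i\<close>, the threshold is the largest exponent outside it. Since
  \<open>0 \<notin> T i\<close>, subtracting 1 from the least element is not truncated.\<close>

lemma staircase_threshold:
  assumes "staircase T"
  obtains t where "\<And>i m. T i \<noteq> {} \<Longrightarrow> m \<in> T i \<longleftrightarrow> t i < m"
proof
  fix i m assume ne: "T i \<noteq> {}"
  define l where "l = (LEAST m. m \<in> T i)"
  have l: "l \<in> T i" "\<And>k. k \<in> T i \<Longrightarrow> l \<le> k"
    unfolding l_def using ne by (auto intro: LeastI Least_le)
  have "0 < l"
    using l(1) assms by (metis staircase_def gr0I)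
  moreover have "k \<in> T i" if "l \<le> k" for k
    using assms l(1) that by (metis staircase_def le_add_diff_inverse)
  ultimately show "m \<in> T i \<longleftrightarrow> (LEAST m. m \<in> T i) - 1 < m"
    using l(2)[of m] unfolding l_def[symmetric] by force
qed

text \<open>For a term of \<open>f\<close> outside the corner and a term of \<open>g\<close> of degree \<open>0\<close> in the
  variables occurring in \<open>T\<close>, the product is again outside the corner; choosing both minimal
  prevents cancellation.\<close>

lemma mult_not_in_corner:
  fixes f g :: "('n::finite, 'k::field) mpoly"
  assumes st: "staircase T" and f: "f \<notin> supported (corner T)"
    and g: "g \<notin> supported (corner (rad T))"
  shows "f * g \<notin> supported (corner T)"
proof
  assume fg: "f * g \<in> supported (corner T)"
  obtain f1 f2 where fs: "f = f1 + f2" "keys f1 = keys f \<inter> corner T" "keys f2 = keys f - corner T"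
    by (rule mpoly_split)
  have id: "ideal (supported (corner T) :: ('n, 'k) mpoly set) mpoly_ring"
    using st by (intro ideal_supported up_closed_corner)
  have "f1 \<in> supported (corner T)"
    using fs(2) by (auto simp: supported_def)
  \<comment> \<open>Modulo the ideal only \<open>f2\<close>, the part of \<open>f\<close> without
    terms in the corner, matters.\<close>
  then have "f * g + (- g) * f1 \<in> supported (corner T)"
    using id fg unfolding ideal_type_iff by blast
  also have "f * g + (- g) * f1 = f2 * g"
    by (simp add: fs(1) algebra_simps)
  finally have f2g: "keys (f2 * g) \<subseteq> corner T"
    by (simp add: supported_def)
  have "f2 \<noteq> 0" "g \<noteq> 0"
    using f g fs(3) by (auto simp: supported_def)
  then obtain a b where ab: "a \<in> keys f2" "b \<in> keys g" "a + b \<in> keys (f2 * g)"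
    "\<And>c. c \<in> keys g \<Longrightarrow> partial_degree {i. T i \<noteq> {}} b \<le> partial_degree {i. T i \<noteq> {}} c"
    by (rule min_term_mult[where S = "{i. T i \<noteq> {}}"]) blast
  obtain c where c: "c \<in> keys g" "c \<notin> corner (rad T)"
    using g by (auto simp: supported_def)
  \<comment> \<open>\<open>c\<close> uses no variable of \<open>T\<close>; by minimality neither
    does \<open>b\<close>.\<close>
  have "partial_degree {i. T i \<noteq> {}} c = 0"
    using c(2) by (auto simp: partial_degree_def in_corner_rad_iff)
  then have b0: "lookup b i = 0" if "T i \<noteq> {}" for i
    using ab(4)[OF c(1)] that by (simp add: partial_degree_def)
  obtain i where i: "lookup a i + lookup b i \<in> T i"
    using subsetD[OF f2g ab(3)] by (auto simp: in_corner_iff lookup_add)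
  then have "lookup a i \<in> T i"
    using b0[of i] by (metis add_0_right empty_iff)
  then show False
    using ab(1) fs(3) by (auto simp: in_corner_iff)
qed

text \<open>As \<open>rad T\<close> is fixed by \<open>rad\<close>,
  \<open>mult_not_in_corner\<close> for it is the contrapositive of the prime condition.\<close>

lemma primeideal_corner_rad:
  "primeideal (supported (corner (rad T)) :: ('n::finite, 'k::field) mpoly set) mpoly_ring"
  using mult_not_in_corner[of "rad T"] staircase_rad[of T]
  by (auto simp: primeideal_type_iff ideal_supported up_closed_corner zero_notin_corner)

lemma primeideal_power:
  fixes P :: "'a::comm_ring_1 set"
  assumes "primeideal P ring_of_type_algebra" "x ^ m \<in> P"
  shows "x \<in> P"
  using assms(2) assms(1) by (induction m) (auto simp: primeideal_type_iff)

lemma partial_degree_keys_power: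
  fixes f :: "('n::finite, 'k::field) mpoly"
  assumes "\<And>a. a \<in> keys f \<Longrightarrow> 0 < partial_degree S a" "c \<in> keys (f ^ N)"
  shows "N \<le> partial_degree S c"
  using assms(2)
proof (induction N arbitrary: c)
  case (Suc N)
  then obtain a b where "c = a + b" "a \<in> keys f" "b \<in> keys (f ^ N)"
    using keys_mult[of f "f ^ N"] by auto
  then show ?case
    using Suc.IH[of b] assms(1)[of a] by (simp add: partial_degree_add)
qed simp

text \<open>The right side is prime and contains the ideal, hence contains its radical. Conversely
  every term of \<open>f ^ N\<close> has degree at least \<open>N\<close> in the variables of
  \<open>T\<close>; once \<open>N\<close> exceeds the sum of the thresholds, some exponent passes
  its threshold.\<close>

lemma radical_corner:
  assumes st: "staircase T"
  shows "radical_ideal mpoly_ring (supported (corner T) :: ('n::finite, 'k::field) mpoly set)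
    = supported (corner (rad T))"
proof (intro antisym subsetI)
  fix f :: "('n, 'k) mpoly"
  assume "f \<in> radical_ideal mpoly_ring (supported (corner T))"
  then obtain m where "f ^ m \<in> supported (corner T)"
    by (auto simp: radical_ideal_type)
  then have "f ^ m \<in> supported (corner (rad T))"
    using supported_mono[OF corner_subset_rad[OF st]] by blast
  then show "f \<in> supported (corner (rad T))"
    by (rule primeideal_power[OF primeideal_corner_rad])
next
  fix f :: "('n, 'k) mpoly"
  assume f: "f \<in> supported (corner (rad T))"
  define S where "S = {i. T i \<noteq> {}}"
  obtain t where t: "\<And>i m. T i \<noteq> {} \<Longrightarrow> m \<in> T i \<longleftrightarrow> t i < m"
    using staircase_threshold[OF st] by blast
  define N where "N = Suc (\<Sum>i\<in>S. t i)"
  have pos: "0 < partial_degree S a" if "a \<in> keys f" for a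
  proof -
    have "a \<in> corner (rad T)"
      using f that by (auto simp: supported_def)
    then obtain i where "i \<in> S" "0 < lookup a i"
      by (auto simp: in_corner_rad_iff S_def)
    then show ?thesis
      unfolding partial_degree_def by (intro sum_pos2[of S i]) auto
  qed
  have "c \<in> corner T" if "c \<in> keys (f ^ N)" for c
  proof (rule ccontr)
    assume "c \<notin> corner T"
    then have "lookup c i \<le> t i" if "i \<in> S" for i
      using t[of i "lookup c i"] that by (auto simp: in_corner_iff S_def not_less)
    then have "partial_degree S c \<le> (\<Sum>i\<in>S. t i)"
      unfolding partial_degree_def by (rule sum_mono)
    with partial_degree_keys_power[OF pos that] show False
      by (simp add: N_def)
  qed
  then have "f ^ N \<in> supported (corner T)"
    by (auto simp: supported_def)
  then show "f \<in> radical_ideal mpoly_ring (supported (corner T))"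
    by (auto simp: radical_ideal_type)
qed

text \<open>With the radical known, \<open>mult_not_in_corner\<close> is the primary
  condition.\<close>

lemma primary_corner:
  assumes "staircase T"
  shows "primary_ideal (supported (corner T) :: ('n::finite, 'k::field) mpoly set) mpoly_ring"
proof -
  have "(supported (corner T) :: ('n, 'k) mpoly set) \<noteq> UNIV"
    using one_in_supported zero_notin_corner[OF assms] by blast
  then show ?thesis
    using mult_not_in_corner[OF assms]
    by (auto simp: primary_ideal_def radical_corner assms ideal_supported up_closed_corner)
qed

section \<open>Irreducible monomial ideals\<close>

text \<open>Every ideal strictly above a corner ideal contains a multiple of the top monomial \<open>p\<close>
  by a polynomial with a term free of the variables in \<open>T\<close>: multiply a term of lowest degree in
  these variables up to \<open>p\<close>, which pushes every other term into the corner unless it has the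
  same exponents there.\<close>

lemma socle_multiple:
  fixes J :: "('n::finite, 'k::field) mpoly set"
  assumes st: "staircase T" and t: "\<And>i m. T i \<noteq> {} \<Longrightarrow> m \<in> T i \<longleftrightarrow> t i < m"
    and p: "\<And>i. lookup p i = (if T i = {} then 0 else t i)"
    and J: "ideal J mpoly_ring" and less: "supported (corner T) \<subset> J"
  obtains F where "F \<notin> supported (corner (rad T))" "F * monomial p \<in> J"
proof -
  define S where "S = {i. T i \<noteq> {}}"
  have add: "x + y \<in> J" if "x \<in> J" "y \<in> J" for x y
    using J that by (simp add: ideal_type_iff)
  have mult: "r * x \<in> J" if "x \<in> J" for x r
    using J that by (simp add: ideal_type_iff)
  have reduce: "g2 \<in> J" if "g1 + g2 \<in> J" "keys g1 \<subseteq> corner T" for g1 g2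
  proof -
    have "g1 \<in> J"
      using that(2) less by (auto simp: supported_def)
    then have "(g1 + g2) + (- 1) * g1 \<in> J"
      by (intro add mult that)
    then show ?thesis by simp
  qed
  obtain f where f: "f \<in> J" "f \<notin> supported (corner T)"
    using less by blast
  obtain f1 f2 where fs: "f = f1 + f2" "keys f1 = keys f \<inter> corner T" "keys f2 = keys f - corner T"
    by (rule mpoly_split)
  have f2: "f2 \<in> J"
    using reduce[of f1 f2] f fs by auto
  have "\<exists>a. a \<in> keys f2"
    using f(2) fs(3) by (auto simp: supported_def)
  then obtain a where a: "a \<in> keys f2" "\<And>c. c \<in> keys f2 \<Longrightarrow> partial_degree S a \<le> partial_degree S c"
    using ex_has_least_nat[of "\<lambda>a. a \<in> keys f2" _ "partial_degree S"] by blast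
  have bound: "lookup c i \<le> t i \<longleftrightarrow> lookup c i \<notin> T i" if "i \<in> S" for c :: "'n \<Rightarrow>\<^sub>0 nat" and i
    using t[of i "lookup c i"] that by (auto simp: S_def)
  have a_le: "lookup a i \<le> t i" if "i \<in> S" for i
    using a(1) fs(3) that by (auto simp: bound in_corner_iff)
  \<comment> \<open>\<open>monomial u\<close> lifts \<open>a\<close> to \<open>p\<close> in the
    variables of \<open>T\<close> and leaves the others alone, where \<open>p\<close> is 0.\<close>
  define u where "u = p - a"
  have u: "lookup u i = (if i \<in> S then t i - lookup a i else 0)" for i
    by (simp add: u_def lookup_diff_exponent p S_def)
  define h where "h = monomial u * f2"
  have keys_h: "\<exists>c\<in>keys f2. b = u + c" if "b \<in> keys h" for b
    using keys_mult[of "monomial u" f2] that by (auto simp: h_def)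
  \<comment> \<open>If \<open>u + c\<close> stays outside the corner, \<open>c\<close> exceeds
    \<open>a\<close> in no variable of \<open>S\<close>, so minimality of the degree of
    \<open>a\<close> forces equality there.\<close>
  have top: "lookup (u + c) i = t i" if c: "c \<in> keys f2" "u + c \<notin> corner T" and i: "i \<in> S" for c i
  proof -
    have le: "lookup c j \<le> lookup a j" if "j \<in> S" for j
    proof -
      have "lookup (u + c) j \<le> t j"
        using c(2) bound[OF that, of "u + c"] by (auto simp: in_corner_iff)
      then show ?thesis
        using that a_le[OF that] by (simp add: lookup_add u)
    qed
    have "lookup c i = lookup a i"
    proof (rule ccontr)
      assume "lookup c i \<noteq> lookup a i"
      then have "partial_degree S c < partial_degree S a"
        unfolding partial_degree_def using le i
        by (intro sum_strict_mono_ex1) (auto intro!: bexI[of _ i] le_neq_implies_less)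
      with a(2)[OF c(1)] show False by simp
    qed
    then show ?thesis
      using i a_le[OF i] by (simp add: lookup_add u)
  qed
  obtain h1 h2 where hs: "h = h1 + h2" "keys h1 = keys h \<inter> corner T" "keys h2 = keys h - corner T"
    by (rule mpoly_split)
  have h2: "h2 \<in> J"
    using reduce[of h1 h2] mult[OF f2, of "monomial u"] hs by (auto simp: h_def)
  have top2: "lookup b i = t i" if "b \<in> keys h2" "i \<in> S" for b i
    using keys_h[of b] that hs(3) top by auto
  \<comment> \<open>The term at \<open>u + a\<close> stays outside the corner and keeps the
    coefficient of \<open>f2\<close> at \<open>a\<close>.\<close>
  have "h2 \<noteq> 0"
  proof -
    have "lookup h (u + a) = lookup f2 a"
    proof -
      obtain g1 g2 where g: "f2 = g1 + g2" "keys g1 = keys f2 \<inter> {a}" "keys g2 = keys f2 - {a}"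
        by (rule mpoly_split)
      have "u + a \<notin> keys (monomial u * g2)"
        using keys_mult[of "monomial u" g2] g(3) by auto
      moreover have "g1 = Poly_Mapping.single a (lookup g1 a)"
        using mpoly_expand[of g1] g(2) a(1) by auto
      then have "lookup (monomial u * g1) (u + a) = lookup g1 a"
        by (metis lookup_single_eq monomial_def mult_single mult_1)
      moreover have "lookup g2 a = 0"
        using g(3) by (metis DiffD2 not_in_keys_iff_lookup_eq_zero singletonI)
      ultimately show ?thesis
        unfolding h_def g(1) by (simp add: distrib_left lookup_add in_keys_iff)
    qed
    then have "u + a \<in> keys h"
      using a(1) by (simp add: in_keys_iff)
    moreover have "u + a \<notin> corner T"
    proof
      assume "u + a \<in> corner T"
      then obtain i where i: "lookup (u + a) i \<in> T i"
        by (auto simp: in_corner_iff)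
      then have "i \<in> S" by (auto simp: S_def)
      with i bound[of i "u + a"] a_le[of i] show False
        by (simp add: lookup_add u)
    qed
    ultimately show ?thesis
      using hs(3) by auto
  qed
  \<comment> \<open>\<open>p\<close> agrees with every exponent of \<open>h2\<close> on
    \<open>S\<close> and is 0 elsewhere, so \<open>monomial p\<close> divides \<open>h2\<close>; the
    quotient \<open>F\<close> is free of the variables in \<open>S\<close>.\<close>
  define F where "F = (\<Sum>b\<in>keys h2. Poly_Mapping.single (b - p) (lookup h2 b))"
  have "F * monomial p = (\<Sum>b\<in>keys h2. Poly_Mapping.single b (lookup h2 b))"
    unfolding F_def sum_distrib_right
  proof (rule sum.cong)
    fix b assume b: "b \<in> keys h2"
    have "b - p + p = b"
      using top2[OF b] by (intro poly_mapping_eqI) (auto simp: lookup_add lookup_diff_exponent p S_def)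
    then show "Poly_Mapping.single (b - p) (lookup h2 b) * monomial p = Poly_Mapping.single b (lookup h2 b)"
      by (simp add: monomial_def mult_single)
  qed simp
  also have "\<dots> = h2"
    by (rule mpoly_expand[symmetric])
  finally have Fp: "F * monomial p = h2" .
  then have "F \<noteq> 0"
    using \<open>h2 \<noteq> 0\<close> by auto
  then obtain k where k: "k \<in> keys F"
    by (metis ex_in_conv keys_eq_empty)
  then have "(\<Sum>b\<in>keys h2. lookup (Poly_Mapping.single (b - p) (lookup h2 b)) k) \<noteq> 0"
    by (simp add: in_keys_iff F_def lookup_sum)
  then obtain b where b: "b \<in> keys h2" "lookup (Poly_Mapping.single (b - p) (lookup h2 b)) k \<noteq> 0"
    by (rule sum.not_neutral_contains_not_neutral)
  then have "k = b - p"
    by (auto simp: lookup_single when_def split: if_splits)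
  then have "k \<notin> corner (rad T)"
    using top2[OF b(1)] by (auto simp: in_corner_rad_iff lookup_diff_exponent p S_def)
  then have "F \<notin> supported (corner (rad T))"
    using k by (auto simp: supported_def)
  then show ?thesis
    using that h2 Fp by metis
qed

lemma finite_exponent_exists: "\<exists>p :: 'n::finite \<Rightarrow>\<^sub>0 nat. \<forall>i. lookup p i = h i"
  by (intro exI[of _ "Poly_Mapping.Abs_poly_mapping h"]) (simp add: lookup_Abs_poly_mapping)

text \<open>Two strictly larger ideals contain multiples \<open>F * monomial p\<close> and
  \<open>G * monomial p\<close> of the same top monomial, with \<open>F\<close> and \<open>G\<close>
  outside the radical. Then \<open>F * G * monomial p\<close> lies in both, but by
  \<open>mult_not_in_corner\<close> not in the corner ideal.\<close>

lemma irreducible_corner: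
  assumes st: "staircase T"
  shows "irreducible_ideal (supported (corner T) :: ('n::finite, 'k::field) mpoly set) mpoly_ring"
proof -
  obtain t where t: "\<And>i m. T i \<noteq> {} \<Longrightarrow> m \<in> T i \<longleftrightarrow> t i < m"
    using staircase_threshold[OF st] by blast
  obtain p :: "'n \<Rightarrow>\<^sub>0 nat" where p: "\<And>i. lookup p i = (if T i = {} then 0 else t i)"
    using finite_exponent_exists[of "\<lambda>i. if T i = {} then 0 else t i"] by auto
  have "p \<notin> corner T"
    using t p by (auto simp: in_corner_iff split: if_splits)
  then have pJ: "(monomial p :: ('n, 'k) mpoly) \<notin> supported (corner T)"
    by simp
  have "False"
    if J: "ideal J1 mpoly_ring" "ideal J2 mpoly_ring" "supported (corner T) \<subset> J1"
      "supported (corner T) \<subset> J2" "supported (corner T) = J1 \<inter> J2" for J1 J2 :: "('n, 'k) mpoly set"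
  proof -
    obtain F where F: "F \<notin> supported (corner (rad T))" "F * monomial p \<in> J1"
      using socle_multiple[OF st t p J(1,3)] by blast
    obtain G where G: "G \<notin> supported (corner (rad T))" "G * monomial p \<in> J2"
      using socle_multiple[OF st t p J(2,4)] by blast
    have "G * (F * monomial p) \<in> J1" "F * (G * monomial p) \<in> J2"
      using J F G by (auto simp: ideal_type_iff)
    then have "monomial p * F * G \<in> supported (corner T)"
      using J(5) by (simp add: ac_simps)
    moreover have "monomial p * F * G \<notin> supported (corner T)"
      by (intro mult_not_in_corner st pJ F(1) G(1))
    ultimately show False by simp
  qed
  moreover have "(supported (corner T) :: ('n, 'k) mpoly set) \<noteq> UNIV"
    using pJ by blast
  moreover have "ideal (supported (corner T) :: ('n, 'k) mpoly set) mpoly_ring"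
    using st by (intro ideal_supported up_closed_corner)
  ultimately show ?thesis
    unfolding irreducible_ideal_def ring_of_type_simps(1) by blast
qed

section \<open>Least common multiples and irreducible ideals\<close>

lemma in_translates_single: "c \<in> translates {a} \<longleftrightarrow> (\<forall>i. lookup a i \<le> lookup c i)"
proof
  assume "\<forall>i. lookup a i \<le> lookup c i"
  then have "c = a + (c - a)"
    by (intro poly_mapping_eqI) (simp add: lookup_add lookup_diff_exponent)
  then show "c \<in> translates {a}"
    by (auto simp: translates_def)
qed (auto simp: translates_def lookup_add)

text \<open>The exponent \<open>a + (b - a)\<close>, with truncated subtraction, is that of the least common
  multiple.\<close>

lemma irreducible_lcm:
  assumes up: "up_closed E"
    and irr: "irreducible_ideal (supported E :: ('n, 'k::field) mpoly set) mpoly_ring"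
    and lcm: "a + (b - a) \<in> E"
  shows "a \<in> E \<or> b \<in> E"
proof (rule ccontr)
  assume "\<not> ?thesis"
  then have nab: "a \<notin> E" "b \<notin> E" by auto
  \<comment> \<open>The ideal enlarged by \<open>monomial c\<close>. For \<open>a\<close> and
    \<open>b\<close> these meet in \<open>supported E\<close>, as a common multiple is a multiple of
    the least one.\<close>
  let ?J = "\<lambda>c. supported (E \<union> translates {c}) :: ('n, 'k) mpoly set"
  have "c \<in> E" if "c \<in> translates {a}" "c \<in> translates {b}" for c
  proof -
    have "c \<in> translates {a + (b - a)}"
      unfolding in_translates_single
    proof
      fix i
      have "lookup a i \<le> lookup c i" "lookup b i \<le> lookup c i"
        using that by (simp_all add: in_translates_single)
      then show "lookup (a + (b - a)) i \<le> lookup c i"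
        unfolding lookup_add lookup_diff_exponent by arith
    qed
    then show ?thesis
      using up lcm by (auto simp: translates_def up_closed_def)
  qed
  then have "supported E = ?J a \<inter> ?J b"
    by (auto simp: supported_def)
  moreover have "ideal (?J c) mpoly_ring" for c
    using up by (intro ideal_supported up_closed_Un) auto
  moreover have "supported E \<subset> ?J c" if "c \<notin> E" for c
    using that subset_translates[of "{c}"] supported_mono[of E "E \<union> translates {c}"] by (auto simp: psubset_eq)
  ultimately have "\<exists>J1 J2. ideal J1 mpoly_ring \<and> ideal J2 mpoly_ring \<and>
      (supported E :: ('n, 'k) mpoly set) \<subset> J1 \<and> supported E \<subset> J2 \<and> supported E = J1 \<inter> J2"
    using nab by (intro exI[of _ "?J a"] exI[of _ "?J b"] conjI)
  with irr show False
    unfolding irreducible_ideal_def by (elim conjE notE)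
qed

text \<open>Iterates \<open>irreducible_lcm\<close> over \<open>M\<close>, starting from the
  monomial 1, which lies outside because the ideal is proper.\<close>

lemma irreducible_common_multiple:
  assumes up: "up_closed E"
    and irr: "irreducible_ideal (supported E :: ('n, 'k::field) mpoly set) mpoly_ring"
    and "finite M" "M \<inter> E = {}"
  shows "\<exists>c. c \<notin> E \<and> (\<forall>a\<in>M. c \<in> translates {a})"
  using assms(3,4)
proof (induction M rule: finite_induct)
  case empty
  have "0 \<notin> E"
  proof
    assume "0 \<in> E"
    then have "E = UNIV"
      using up unfolding up_closed_def by (metis UNIV_eq_I add_0)
    then have "(supported E :: ('n, 'k) mpoly set) = UNIV"
      by (simp add: supported_def)
    with irr show False
      by (simp add: irreducible_ideal_def)
  qed
  then show ?case by auto
next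
  case (insert a M)
  then obtain c where c: "c \<notin> E" "\<And>x. x \<in> M \<Longrightarrow> c \<in> translates {x}"
    by auto
  have "a + (c - a) \<notin> E"
    using irreducible_lcm[OF up irr] c(1) insert.prems by blast
  moreover have "lookup a i \<le> lookup (a + (c - a)) i" "lookup c i \<le> lookup (a + (c - a)) i" for i
    by (simp_all add: lookup_add lookup_diff_exponent)
  then have "a + (c - a) \<in> translates {x}" if "x \<in> insert a M" for x
    using c(2) that unfolding in_translates_single by (metis insertE order_trans)
  ultimately show ?case
    by blast
qed

text \<open>Otherwise each component has a monomial outside \<open>J\<close>. A common multiple of
  these outside \<open>J\<close> would lie in every component and hence in \<open>J\<close>.\<close>

lemma irreducible_contains_component:
  fixes J :: "('n, 'k::field) mpoly set"
  assumes J: "monomial_ideal J" "irreducible_ideal J mpoly_ring"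
    and Ks: "finite Ks" "\<And>K. K \<in> Ks \<Longrightarrow> monomial_ideal K" "\<Inter> Ks \<subseteq> J"
  shows "\<exists>K\<in>Ks. K \<subseteq> J"
proof (rule ccontr)
  assume neg: "\<not> ?thesis"
  obtain E where E: "up_closed E" "J = supported E"
    using J(1) by (auto simp: monomial_ideal_iff)
  have "\<exists>a. a \<notin> E \<and> monomial a \<in> K" if K: "K \<in> Ks" for K
  proof -
    obtain F where "K = supported F"
      using Ks(2)[OF K] by (auto simp: monomial_ideal_iff)
    moreover from this have "\<not> F \<subseteq> E"
      using neg K E(2) supported_mono by blast
    ultimately show ?thesis by auto
  qed
  then obtain e where e: "\<And>K. K \<in> Ks \<Longrightarrow> e K \<notin> E \<and> monomial (e K) \<in> K"
    by metis
  have irr: "irreducible_ideal (supported E :: ('n, 'k) mpoly set) mpoly_ring"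
    using J(2) E(2) by simp
  obtain c where c: "c \<notin> E" "\<And>K. K \<in> Ks \<Longrightarrow> c \<in> translates {e K}"
    using irreducible_common_multiple[OF E(1) irr, of "e ` Ks"] e Ks(1) by auto
  have "monomial c \<in> K" if K: "K \<in> Ks" for K
  proof -
    obtain F where F: "up_closed F" "K = supported F"
      using Ks(2)[OF K] by (auto simp: monomial_ideal_iff)
    then have "e K \<in> F"
      using e[OF K] by simp
    then show ?thesis
      using F c(2)[OF K] by (auto simp: translates_def up_closed_def)
  qed
  then have "monomial c \<in> J"
    using Ks(3) by blast
  with c(1) E(2) show False by simp
qed

section \<open>Existence of irreducible decompositions\<close>

text \<open>Dickson's lemma one coordinate at a time: elements whose new coordinate is at least that of
  all chosen ones are taken care of already, and the remaining ones lie in finitely many slices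
  where that coordinate is constant.\<close>

lemma dickson_coordinates:
  fixes A :: "('n \<Rightarrow>\<^sub>0 nat) set"
  assumes "finite F"
  shows "\<exists>B. finite B \<and> B \<subseteq> A \<and> (\<forall>a\<in>A. \<exists>b\<in>B. \<forall>i\<in>F. lookup b i \<le> lookup a i)"
  using assms
proof (induction F arbitrary: A rule: finite_induct)
  case empty
  show ?case
  proof (cases "A = {}")
    case False
    then obtain a where "a \<in> A" by blast
    then show ?thesis by (intro exI[of _ "{a}"]) auto
  qed auto
next
  case (insert j F)
  obtain B where B: "finite B" "B \<subseteq> A" "\<forall>a\<in>A. \<exists>b\<in>B. \<forall>i\<in>F. lookup b i \<le> lookup a i"
    using insert.IH[of A] by blast
  let ?A = "\<lambda>k. {a \<in> A. lookup a j = k}"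
  have "\<forall>k. \<exists>C. finite C \<and> C \<subseteq> ?A k \<and> (\<forall>a\<in>?A k. \<exists>b\<in>C. \<forall>i\<in>F. lookup b i \<le> lookup a i)"
    by (intro allI insert.IH)
  from choice[OF this] obtain C where
    C: "\<forall>k. finite (C k) \<and> C k \<subseteq> ?A k \<and> (\<forall>a\<in>?A k. \<exists>b\<in>C k. \<forall>i\<in>F. lookup b i \<le> lookup a i)" ..
  have C_fin: "finite (C k)" and C_sub: "C k \<subseteq> ?A k"
    and C_dom: "\<forall>a\<in>?A k. \<exists>b\<in>C k. \<forall>i\<in>F. lookup b i \<le> lookup a i" for k
    using spec[OF C, of k] by simp_all
  define N where "N = (\<Sum>b\<in>B. lookup b j)"
  have N: "lookup b j \<le> N" if "b \<in> B" for b
    unfolding N_def using B(1) that by (intro member_le_sum) auto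
  show ?case
  proof (intro exI conjI ballI)
    show "finite (B \<union> (\<Union>k<N. C k))"
      using B(1) C_fin by simp
    show "B \<union> (\<Union>k<N. C k) \<subseteq> A"
      using B(2) C_sub by blast
    fix a assume a: "a \<in> A"
    show "\<exists>b\<in>B \<union> (\<Union>k<N. C k). \<forall>i\<in>insert j F. lookup b i \<le> lookup a i"
    proof (cases "lookup a j < N")
      case True
      obtain b where b: "b \<in> C (lookup a j)" "\<forall>i\<in>F. lookup b i \<le> lookup a i"
        using bspec[OF C_dom[of "lookup a j"], of a] a by auto
      moreover have "lookup b j = lookup a j"
        using C_sub b(1) by auto
      ultimately show ?thesis
        using True by (intro bexI[of _ b]) auto
    next
      case False
      obtain b where b: "b \<in> B" "\<forall>i\<in>F. lookup b i \<le> lookup a i"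
        using B(3) a by blast
      moreover have "lookup b j \<le> lookup a j"
        using N[OF b(1)] False by linarith
      ultimately show ?thesis
        by (intro bexI[of _ b]) simp_all
    qed
  qed
qed

lemma dickson:
  fixes E :: "('n::finite \<Rightarrow>\<^sub>0 nat) set"
  assumes "up_closed E"
  shows "\<exists>B. finite B \<and> E = translates B"
proof -
  obtain B where B: "finite B" "B \<subseteq> E" "\<forall>a\<in>E. \<exists>b\<in>B. \<forall>i\<in>UNIV. lookup b i \<le> lookup a i"
    using dickson_coordinates[of UNIV E] by auto
  have "E \<subseteq> translates B"
  proof
    fix a assume "a \<in> E"
    then obtain b where "b \<in> B" "a \<in> translates {b}"
      using B(3) by (auto simp: in_translates_single)
    then show "a \<in> translates B"
      by (auto simp: translates_def)
  qed
  moreover have "translates B \<subseteq> E"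
    using B(2) assms by (auto simp: translates_def up_closed_def)
  ultimately show ?thesis
    using B(1) by blast
qed

text \<open>The principal ideal of a monomial is the intersection of the ideals generated by its
  maximal prime power divisors, and sums of monomial ideals distribute over intersections.\<close>

lemma translates_eq_INT_corner:
  fixes B :: "('n::finite \<Rightarrow>\<^sub>0 nat) set"
  assumes "finite B" "0 \<notin> B"
  shows "\<exists>Ts. finite Ts \<and> (\<forall>T\<in>Ts. staircase T) \<and> translates B = (\<Inter>T\<in>Ts. corner T)"
  using assms
proof (induction B rule: finite_induct)
  case empty
  \<comment> \<open>The zero ideal is the corner ideal without generators; an empty family would
    give the whole ring.\<close>
  show ?case
    by (intro exI[of _ "{\<lambda>_. {}}"]) (auto simp: translates_def staircase_def corner_def)
next
  case (insert g B)
  then obtain Ts where Ts: "finite Ts" "\<forall>T\<in>Ts. staircase T" "translates B = (\<Inter>T\<in>Ts. corner T)"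
    by auto
  define add where "add i T = (\<lambda>j. T j \<union> (if j = i then {lookup g i..} else {}))"
    for i and T :: "'n \<Rightarrow> nat set"
  \<comment> \<open>\<open>add i T\<close> adjoins the generator \<open>x_i^m\<close> with
    \<open>m = lookup g i\<close>. For \<open>m = 0\<close> the inequality is trivial and 0 would
    enter the staircase.\<close>
  define Us where "Us = (\<lambda>(i, T). add i T) ` ({i. 0 < lookup g i} \<times> Ts)"
  have in_add: "c \<in> corner (add i T) \<longleftrightarrow> lookup g i \<le> lookup c i \<or> c \<in> corner T" for c i T
    by (auto simp: in_corner_iff add_def)
  have "c \<in> translates (insert g B) \<longleftrightarrow> c \<in> (\<Inter>T\<in>Us. corner T)" for c
  proof -
    have "c \<in> translates (insert g B) \<longleftrightarrow> c \<in> translates {g} \<or> c \<in> translates B"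
      by (auto simp: translates_def)
    also have "\<dots> \<longleftrightarrow> (\<forall>i. lookup g i \<le> lookup c i) \<or> (\<forall>T\<in>Ts. c \<in> corner T)"
      by (simp add: in_translates_single Ts(3))
    also have "\<dots> \<longleftrightarrow> (\<forall>i. 0 < lookup g i \<longrightarrow> lookup g i \<le> lookup c i) \<or> (\<forall>T\<in>Ts. c \<in> corner T)"
      by (metis bot_nat_0.extremum gr0I)
    also have "\<dots> \<longleftrightarrow> c \<in> (\<Inter>T\<in>Us. corner T)"
      by (auto simp: Us_def in_add)
    finally show ?thesis .
  qed
  then have "translates (insert g B) = (\<Inter>T\<in>Us. corner T)"
    by blast
  moreover have "finite Us"
    using Ts(1) by (simp add: Us_def)
  moreover have "staircase U" if "U \<in> Us" for U
    using that Ts(2) by (auto simp: Us_def add_def staircase_def split: if_splits)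
  ultimately show ?case by blast
qed

text \<open>Redundant members are dropped one at a time. Irredundancy will make the radical of each
  component an associated prime.\<close>

lemma minimal_subintersection:
  assumes "finite A"
  shows "\<exists>B\<subseteq>A. (\<Inter>x\<in>B. h x) = (\<Inter>x\<in>A. h x) \<and> (\<forall>x\<in>B. \<not> (\<Inter>y\<in>B - {x}. h y) \<subseteq> h x)"
  using assms
proof (induction A rule: finite_psubset_induct)
  case (psubset A)
  show ?case
  proof (cases "\<forall>x\<in>A. \<not> (\<Inter>y\<in>A - {x}. h y) \<subseteq> h x")
    case True
    then show ?thesis by (intro exI[of _ A]) simp
  next
    case False
    then obtain x where x: "x \<in> A" "(\<Inter>y\<in>A - {x}. h y) \<subseteq> h x" by blast
    then have "A - {x} \<subset> A" by blast
    from psubset.IH[OF this] obtain B where B: "B \<subseteq> A - {x}"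
      "(\<Inter>y\<in>B. h y) = (\<Inter>y\<in>A - {x}. h y)" "\<forall>x\<in>B. \<not> (\<Inter>y\<in>B - {x}. h y) \<subseteq> h x"
      by (elim exE conjE)
    moreover have "(\<Inter>y\<in>A - {x}. h y) = (\<Inter>y\<in>A. h y)"
    proof -
      have "(\<Inter>y\<in>A. h y) = h x \<inter> (\<Inter>y\<in>A - {x}. h y)"
        using x(1) by blast
      with x(2) show ?thesis by (simp only: Int_absorb1)
    qed
    ultimately show ?thesis
      by (intro exI[of _ B] conjI) auto
  qed
qed

lemma irredundant_corner_decomposition:
  fixes I :: "('n::finite, 'k::field) mpoly set"
  assumes "monomial_ideal I" "I \<noteq> UNIV"
  obtains Ts where "finite Ts" "\<And>T. T \<in> Ts \<Longrightarrow> staircase T" "I = supported (\<Inter>T\<in>Ts. corner T)"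
    "\<And>T. T \<in> Ts \<Longrightarrow> \<not> (\<Inter>U\<in>Ts - {T}. corner U) \<subseteq> corner T"
proof -
  obtain E where E: "up_closed E" "I = supported E"
    using assms(1) by (auto simp: monomial_ideal_iff)
  obtain B where B: "finite B" "E = translates B"
    using dickson[OF E(1)] by blast
  have "0 \<notin> B"
  proof
    assume "0 \<in> B"
    then have "E = UNIV"
      by (auto simp: B(2) translates_def) (metis add_0)
    then show False
      using assms(2) by (auto simp: E(2) supported_def)
  qed
  then obtain Ts where Ts: "finite Ts" "\<forall>T\<in>Ts. staircase T" "E = (\<Inter>T\<in>Ts. corner T)"
    using translates_eq_INT_corner[of B] B by auto
  obtain Us where Us: "Us \<subseteq> Ts" "(\<Inter>T\<in>Us. corner T) = (\<Inter>T\<in>Ts. corner T)"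
    "\<forall>x\<in>Us. \<not> (\<Inter>y\<in>Us - {x}. corner y) \<subseteq> corner x"
    using minimal_subintersection[OF Ts(1), of corner] by blast
  show ?thesis
  proof
    show "finite Us"
      using Us(1) Ts(1) by (rule finite_subset)
    show "I = supported (\<Inter>T\<in>Us. corner T)"
      by (simp only: E(2) Ts(3) Us(2))
  qed (use Us Ts(2) in blast)+
qed

section \<open>Associated primes\<close>

text \<open>The prime is the colon ideal of \<open>monomial u\<close>. Irredundancy gives
  \<open>a\<close> in all corners but that of \<open>T\<close>; \<open>u\<close> raises
  \<open>a\<close> in the variables of \<open>T\<close> as far as possible without entering that
  corner, so any further such variable pushes it in.\<close>

lemma associated_prime_corner_rad:
  fixes Ts :: "('n::finite \<Rightarrow> nat set) set"
  assumes st: "\<And>T. T \<in> Ts \<Longrightarrow> staircase T" and T: "T \<in> Ts"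
    and irred: "\<not> (\<Inter>U\<in>Ts - {T}. corner U) \<subseteq> corner T"
  shows "supported (corner (rad T))
    \<in> associated_primes mpoly_ring (supported (\<Inter>T\<in>Ts. corner T) :: ('n, 'k::field) mpoly set)"
proof -
  let ?I = "supported (\<Inter>T\<in>Ts. corner T) :: ('n, 'k) mpoly set"
  obtain a where a: "\<And>U. U \<in> Ts \<Longrightarrow> U \<noteq> T \<Longrightarrow> a \<in> corner U" "a \<notin> corner T"
    using irred by auto
  obtain t where t: "\<And>i m. T i \<noteq> {} \<Longrightarrow> m \<in> T i \<longleftrightarrow> t i < m"
    using staircase_threshold[OF st[OF T]] by blast
  obtain u :: "'n \<Rightarrow>\<^sub>0 nat" where u: "\<And>i. lookup u i = (if T i = {} then lookup a i else t i)"
    using finite_exponent_exists[of "\<lambda>i. if T i = {} then lookup a i else t i"] by auto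
  have "u \<notin> corner T"
    using t u by (auto simp: in_corner_iff split: if_splits)
  have "lookup a i \<le> lookup u i" for i
    using a(2) t[of i "lookup a i"] by (auto simp: u in_corner_iff not_less)
  then have "u \<in> translates {a}"
    by (simp add: in_translates_single)
  then have u_other: "u \<in> corner U" if "U \<in> Ts" "U \<noteq> T" for U
    using a(1)[OF that] up_closed_corner[OF st[OF that(1)]] by (auto simp: translates_def up_closed_def)
  have "g \<in> supported (corner (rad T)) \<longleftrightarrow> g * monomial u \<in> ?I" for g :: "('n, 'k) mpoly"
  proof
    assume g: "g \<in> supported (corner (rad T))"
    show "g * monomial u \<in> ?I"
      unfolding supported_def
    proof clarify
      fix b U
      assume b: "b \<in> keys (g * monomial u)" and U: "U \<in> Ts"
      then obtain c where c: "c \<in> keys g" "b = c + u"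
        using keys_mult[of g "monomial u"] by auto
      show "b \<in> corner U"
      proof (cases "U = T")
        case True
        have "c \<in> corner (rad T)"
          using c(1) g by (auto simp: supported_def)
        then obtain i where "T i \<noteq> {}" "0 < lookup c i"
          by (auto simp: in_corner_rad_iff)
        then have "lookup b i \<in> T i"
          using t by (simp add: c(2) lookup_add u)
        with True show ?thesis by (auto simp: in_corner_iff)
      next
        case False
        then show ?thesis
          using up_closedD[OF up_closed_corner[OF st[OF U]] u_other[OF U], of c]
          by (simp add: c(2) add.commute)
      qed
    qed
  next
    assume "g * monomial u \<in> ?I"
    then have "monomial u * g \<in> supported (corner T)"
      using T by (auto simp: supported_INT mult.commute)
    then show "g \<in> supported (corner (rad T))"
      using mult_not_in_corner[OF st[OF T], of "monomial u" g] \<open>u \<notin> corner T\<close> by auto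
  qed
  then have "supported (corner (rad T)) = {g \<in> UNIV. g * monomial u \<in> ?I}"
    by blast
  then show ?thesis
    unfolding associated_primes_def ring_of_type_simps
    by (intro CollectI conjI primeideal_corner_rad bexI[of _ "monomial u"] UNIV_I)
qed

text \<open>As the prime \<open>(I : f)\<close> is proper, \<open>f\<close> lies outside some corner
  ideal, and \<open>mult_not_in_corner\<close> puts every \<open>g\<close> with
  \<open>g * f \<in> I\<close> in the radical of that ideal.\<close>

lemma associated_prime_subset:
  fixes Ts :: "('n::finite \<Rightarrow> nat set) set"
  assumes st: "\<And>T. T \<in> Ts \<Longrightarrow> staircase T"
    and P: "P \<in> associated_primes mpoly_ring (supported (\<Inter>T\<in>Ts. corner T) :: ('n, 'k::field) mpoly set)"
  shows "\<exists>T\<in>Ts. P \<subseteq> supported (corner (rad T))"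
proof -
  obtain f where f: "primeideal P mpoly_ring" "P = {g. g * f \<in> supported (\<Inter>T\<in>Ts. corner T)}"
    using P by (auto simp: associated_primes_def)
  then have "f \<notin> supported (\<Inter>T\<in>Ts. corner T)"
    by (auto simp: primeideal_type_iff)
  then obtain T where T: "T \<in> Ts" "f \<notin> supported (corner T)"
    by (auto simp: supported_INT)
  have "g \<in> supported (corner (rad T))" if "g \<in> P" for g
  proof -
    have "f * g \<in> supported (corner T)"
      using that T(1) by (auto simp: f(2) supported_INT mult.commute)
    then show ?thesis
      using mult_not_in_corner[OF st[OF T(1)] T(2)] by blast
  qed
  with T(1) show ?thesis by blast
qed

text \<open>A maximal one among the finitely many component radicals is maximal among all associated
  primes, since each of these lies in some component radical.\<close>

lemma max_associated_prime_above:
  fixes Ts :: "('n::finite \<Rightarrow> nat set) set"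
  assumes fin: "finite Ts" and st: "\<And>T. T \<in> Ts \<Longrightarrow> staircase T"
    and irred: "\<And>T. T \<in> Ts \<Longrightarrow> \<not> (\<Inter>U\<in>Ts - {T}. corner U) \<subseteq> corner T"
    and T: "T \<in> Ts"
  shows "\<exists>P\<in>max_associated_primes mpoly_ring (supported (\<Inter>T\<in>Ts. corner T) :: ('n, 'k::field) mpoly set).
    supported (corner (rad T)) \<subseteq> P"
proof -
  let ?I = "supported (\<Inter>T\<in>Ts. corner T) :: ('n, 'k) mpoly set"
  let ?Q = "\<lambda>T. supported (corner (rad T)) :: ('n, 'k) mpoly set"
  have "\<exists>P\<in>?Q ` Ts. ?Q T \<subseteq> P \<and> (\<forall>P'\<in>?Q ` Ts. P \<subseteq> P' \<longrightarrow> P = P')"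
    by (rule finite_has_maximal2) (use fin T in simp_all)
  then obtain P where P: "P \<in> ?Q ` Ts" "?Q T \<subseteq> P" "\<forall>P'\<in>?Q ` Ts. P \<subseteq> P' \<longrightarrow> P = P'"
    by (elim bexE conjE)
  obtain U where U: "U \<in> Ts" "P = ?Q U"
    using P(1) by blast
  have "P \<in> associated_primes mpoly_ring ?I"
    unfolding U(2) using st U(1) irred[OF U(1)] by (rule associated_prime_corner_rad)
  moreover have "P' = P" if P': "P' \<in> associated_primes mpoly_ring ?I" "P \<subseteq> P'" for P'
  proof -
    obtain V where V: "V \<in> Ts" "P' \<subseteq> ?Q V"
      using associated_prime_subset[OF st P'(1)] by blast
    then have "P = ?Q V"
      using P(3) P'(2) by (metis imageI order_trans)
    with V(2) P'(2) show ?thesis by (metis subset_antisym)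
  qed
  ultimately have "P \<in> max_associated_primes mpoly_ring ?I"
    unfolding max_associated_primes_def by blast
  with P(2) show ?thesis ..
qed

section \<open>Independence of the decompositions\<close>

text \<open>\<open>Q\<^bsub>\<subseteq>P\<^esub>\<close> is the contraction of the localisation of \<open>I\<close> at \<open>P\<close>.\<close>

lemma components_below_localisation:
  fixes I :: "('n, 'k::field) mpoly set"
  assumes Qs: "monomial_primary_decomposition Qs I" and P: "primeideal P mpoly_ring"
  shows "components_below Qs P = {f. \<exists>s. s \<notin> P \<and> s * f \<in> I}"
proof (intro antisym subsetI)
  have fin: "finite Qs" and prim: "\<And>Q. Q \<in> Qs \<Longrightarrow> primary_ideal Q mpoly_ring" and I: "I = \<Inter> Qs"
    using Qs by (auto simp: monomial_primary_decomposition_def)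
  have idl: "r * x \<in> Q" if "Q \<in> Qs" "x \<in> Q" for Q r x
    using prim[OF that(1)] that(2) by (auto simp: primary_ideal_def ideal_type_iff)
  fix f :: "('n, 'k) mpoly"
  { assume f: "f \<in> components_below Qs P"
    \<comment> \<open>One multiplier serves all components: each whose radical is not inside
      \<open>P\<close> contributes a factor \<open>r ^ m\<close> lying in it, with
      \<open>r \<notin> P\<close>.\<close>
    have "\<exists>s. s \<notin> P \<and> (\<forall>Q\<in>M. s * f \<in> Q)" if "finite M" "M \<subseteq> Qs" for M
      using that
    proof (induction M rule: finite_induct)
      case empty
      show ?case
        using P by (auto simp: primeideal_type_iff)
    next
      case (insert Q M)
      then obtain s where s: "s \<notin> P" "\<forall>Q\<in>M. s * f \<in> Q" by auto
      have Q: "Q \<in> Qs" using insert.prems by simp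
      show ?case
      proof (cases "radical_ideal mpoly_ring Q \<subseteq> P")
        case True
        then have "f \<in> Q"
          using f Q by (auto simp: components_below_def)
        with s idl[OF Q] show ?thesis by auto
      next
        case False
        then obtain r m where r: "r \<notin> P" "r ^ m \<in> Q"
          by (auto simp: radical_ideal_type)
        have "r ^ m * s \<notin> P"
          using P r(1) s(1) primeideal_power[OF P] by (auto simp: primeideal_type_iff)
        moreover have "r ^ m * s * f \<in> Q"
          using idl[OF Q r(2), of "s * f"] by (simp add: ac_simps)
        moreover have "r ^ m * s * f \<in> Q'" if "Q' \<in> M" for Q'
          using idl[of Q' "s * f" "r ^ m"] s(2) that insert.prems by (auto simp: ac_simps)
        ultimately show ?thesis by auto
      qed
    qed
    from this[OF fin] show "f \<in> {f. \<exists>s. s \<notin> P \<and> s * f \<in> I}"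
      by (auto simp: I) }
  { assume "f \<in> {f. \<exists>s. s \<notin> P \<and> s * f \<in> I}"
    then obtain s where s: "s \<notin> P" "s * f \<in> I" by auto
    \<comment> \<open>\<open>s\<close> lies outside the radical of \<open>Q\<close>, so the primary
      condition applies to \<open>s * f\<close>.\<close>
    have "f \<in> Q" if "Q \<in> Qs" "radical_ideal mpoly_ring Q \<subseteq> P" for Q
      using prim[OF that(1)] s that unfolding primary_ideal_def I
      by (auto simp: mult.commute)
    then show "f \<in> components_below Qs P"
      by (auto simp: components_below_def) }
qed

text \<open>By \<open>components_below_localisation\<close> the components below a prime depend on
  \<open>I\<close> alone, so \<open>THE\<close> has a unique candidate.\<close>

lemma symbolic_polyhedron_eq:
  fixes I :: "('n::finite, 'k::field) mpoly set"
  assumes "monomial_primary_decomposition Qs I"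
  shows "symbolic_polyhedron I =
    (\<Inter>P\<in>max_associated_primes mpoly_ring I. newton_polyhedron (components_below Qs P))"
  unfolding symbolic_polyhedron_def
proof (rule the_equality)
  have "components_below Qs' P = components_below Qs P"
    if "monomial_primary_decomposition Qs' I" "P \<in> max_associated_primes mpoly_ring I" for Qs' P
  proof -
    have P: "primeideal P mpoly_ring"
      using that(2) by (simp add: max_associated_primes_def associated_primes_def)
    show ?thesis
      by (simp only: components_below_localisation[OF that(1) P] components_below_localisation[OF assms P])
  qed
  then show "S = (\<Inter>P\<in>max_associated_primes mpoly_ring I. newton_polyhedron (components_below Qs P))"
    if "\<exists>Qs. monomial_primary_decomposition Qs I \<and>
     S = (\<Inter>P\<in>max_associated_primes mpoly_ring I. newton_polyhedron (components_below Qs P))" for S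
    using that by (elim exE conjE) (simp cong: INF_cong)
qed (use assms in blast)

lemma newton_polyhedron_mono: "J \<subseteq> J' \<Longrightarrow> newton_polyhedron J \<subseteq> newton_polyhedron J'"
  unfolding newton_polyhedron_def by (rule hull_mono) blast

text \<open>By \<open>irreducible_contains_component\<close> any two decompositions refine each
  other, so monotonicity gives both inclusions.\<close>

lemma irreducible_polyhedron_eq:
  fixes I :: "('n::finite, 'k::field) mpoly set"
  assumes "monomial_irreducible_decomposition Js I"
  shows "irreducible_polyhedron I = (\<Inter>J\<in>Js. newton_polyhedron J)"
  unfolding irreducible_polyhedron_def
proof (rule the_equality)
  have le: "(\<Inter>J\<in>As. newton_polyhedron J) \<subseteq> (\<Inter>J\<in>Bs. newton_polyhedron J)"
    if dec: "monomial_irreducible_decomposition As I" "monomial_irreducible_decomposition Bs I" for As Bs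
  proof (rule INT_greatest)
    fix J assume "J \<in> Bs"
    then obtain K where "K \<in> As" "K \<subseteq> J"
      using irreducible_contains_component[of J As] dec
      unfolding monomial_irreducible_decomposition_def by blast
    then show "(\<Inter>J\<in>As. newton_polyhedron J) \<subseteq> newton_polyhedron J"
      using newton_polyhedron_mono by blast
  qed
  show "S = (\<Inter>J\<in>Js. newton_polyhedron J)"
    if "\<exists>Js. monomial_irreducible_decomposition Js I \<and> S = (\<Inter>J\<in>Js. newton_polyhedron J)" for S
    using that by (elim exE conjE) (simp only: subset_antisym[OF le[OF _ assms] le[OF assms]])
qed (use assms in blast)

section \<open>Comparison of the three polyhedra through one common decomposition\<close>

theorem theorem3p9:
  fixes I :: "('n::finite, 'k::field) mpoly set"
  assumes "monomial_ideal I" and "I \<noteq> carrier mpoly_ring"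
  shows "newton_polyhedron I \<subseteq> symbolic_polyhedron I \<and>
         symbolic_polyhedron I \<subseteq> irreducible_polyhedron I"
proof -
  have "I \<noteq> UNIV"
    using assms(2) by simp
  then obtain Ts where Ts: "finite Ts" "\<And>T. T \<in> Ts \<Longrightarrow> staircase T"
    "I = supported (\<Inter>T\<in>Ts. corner T)"
    "\<And>T. T \<in> Ts \<Longrightarrow> \<not> (\<Inter>U\<in>Ts - {T}. corner U) \<subseteq> corner T"
    using irredundant_corner_decomposition[OF assms(1)] by blast
  define Js where "Js = (\<lambda>T. supported (corner T) :: ('n, 'k) mpoly set) ` Ts"
  have irr: "monomial_irreducible_decomposition Js I"
    using Ts by (auto simp: monomial_irreducible_decomposition_def Js_def supported_INT
        monomial_ideal_supported up_closed_corner irreducible_corner)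
  have prim: "monomial_primary_decomposition Js I"
    using Ts by (auto simp: monomial_primary_decomposition_def Js_def supported_INT
        monomial_ideal_supported up_closed_corner primary_corner)
  have "newton_polyhedron I \<subseteq> newton_polyhedron (components_below Js P)" for P
    using prim by (intro newton_polyhedron_mono)
      (auto simp: components_below_def monomial_primary_decomposition_def)
  moreover have "symbolic_polyhedron I \<subseteq> newton_polyhedron (supported (corner T) :: ('n, 'k) mpoly set)"
    if T: "T \<in> Ts" for T
  proof -
    obtain P where P: "P \<in> max_associated_primes mpoly_ring I"
      "supported (corner (rad T)) \<subseteq> P"
      using max_associated_prime_above[OF Ts(1,2,4) T] Ts(3) by blast
    have "symbolic_polyhedron I \<subseteq> newton_polyhedron (components_below Js P)"
      unfolding symbolic_polyhedron_eq[OF prim] using P(1) by (rule INT_lower)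
    \<comment> \<open>The radical of this component lies in \<open>P\<close>, so it is among those
      intersected.\<close>
    moreover have "components_below Js P \<subseteq> supported (corner T)"
      using T P(2) Ts(2) unfolding components_below_def Js_def
      by (intro Inter_lower) (simp add: radical_corner)
    ultimately show ?thesis
      using newton_polyhedron_mono by blast
  qed
  ultimately show ?thesis
    unfolding irreducible_polyhedron_eq[OF irr] symbolic_polyhedron_eq[OF prim] Js_def image_image
    by (intro conjI INT_greatest) simp_all
qed

end
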